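(* Let $N\ge1$ be an integer and $h=\frac1N$. In the space $L_2^{(2)}(0,1)$, among quadrature formulas of the form $$\int_0^1\varphi(x)\,dx\cong\sum_{\beta=0}^N C[\beta]\,\varphi(h\beta)+A\varphi'(0)+B\varphi'(1)$$ there exists a unique optimal formula, and its coefficients are $$C[\beta]=\begin{cases}\frac h2,&\beta=0,N,\\ h,&\beta=1,\dots,N-1,\end{cases}\qquad A=\frac{h^2}{12},\qquad B=-\frac{h^2}{12}.$$ Furthermore, the error functional $\ell$ of this optimal formula satisfies $$\left\|\ell|L_2^{(2)*}(0,1)\right\|^2=\frac{h^4}{720}.$$
   Context: $L_2^{(2)}(0,1)$ is the Sobolev space of real functions $\varphi$ on $[0,1]$ with $\varphi''\in L_2(0,1)$, equipped with the (semi)norm $\|\varphi\|_{L_2^{(2)}(0,1)}=\left(\int_0^1(\varphi''(x))^2dx\right)^{1/2}$. For real coefficients $C[0],\dots,C[N],A,B$, the error functional of the quadrature formula is $$(\ell,\varphi)=\int_0^1\varphi(x)\,dx-\sum_{\beta=0}^N C[\beta]\varphi(h\beta)-A\varphi'(0)-B\varphi'(1),$$ and its norm is $\|\ell|L_2^{(2)*}(0,1)\|=\sup_{\|\varphi\|_{L_2^{(2)}(0,1)}=1}|(\ell,\varphi)|$. Finiteness of this norm requires $(\ell,x^\alpha)=0$ for $\alpha=0,1$. The quadrature formula is called optimal if its coefficients attain the infimum of $\|\ell|L_2^{(2)*}(0,1)\|$ over all choices of $C[\beta]$ ($0\le\beta\le N$), $A$, $B$, with the nodes $h\beta$ fixed.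 *)

theory Defs
  imports "HOL-Analysis.Analysis"
begin

text \<open>
  Functions on $[0,1]$ are total functions on the reals of which only the values on $[0,1]$ matter:
  derivatives are taken within $[0,1]$, so at the endpoints they are one-sided.
\<close>

definition D01 :: "(real \<Rightarrow> real) \<Rightarrow> real \<Rightarrow> real" where
  "D01 \<phi> x = vector_derivative \<phi> (at x within {0..1})"

definition absolutely_continuous_fun_on :: "real set \<Rightarrow> (real \<Rightarrow> real) \<Rightarrow> bool" where
  "absolutely_continuous_fun_on S f \<longleftrightarrow>
     (\<forall>\<epsilon>>0. \<exists>\<delta>>0. \<forall>d t. d division_of t \<and> t \<subseteq> S \<and> (\<Sum>k\<in>d. Sup k - Inf k) < \<delta> \<longrightarrow>
        (\<Sum>k\<in>d. \<bar>f (Sup k) - f (Inf k)\<bar>) < \<epsilon>)"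

text \<open>
  In one dimension a function has a generalized second derivative in $L_2(0,1)$ iff (its continuous
  representative) is differentiable on $[0,1]$ with absolutely continuous derivative whose
  almost-everywhere derivative is in $L_2(0,1)$; that derivative is then the generalized one.
  The representative is what gives meaning to the values of the function at the nodes and of its
  derivative at 0 and 1. By Lebesgue's theorem the almost-everywhere differentiability below already
  follows from absolute continuity. \<open>D01 (D01 \<phi>)\<close> has an unspecified value on the
  exceptional null set, which affects neither measurability nor integrals over the complete
  measure \<open>lebesgue_on {0..1}\<close>.
\<close>

definition L22 :: "(real \<Rightarrow> real) set" where
  "L22 = {\<phi>. \<phi> differentiable_on {0..1} \<and>
              absolutely_continuous_fun_on {0..1} (D01 \<phi>) \<and>
              (AE x in lebesgue_on {0..1}. D01 \<phi> differentiable (at x within {0..1})) \<and>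
              D01 (D01 \<phi>) \<in> borel_measurable (lebesgue_on {0..1}) \<and>
              integrable (lebesgue_on {0..1}) (\<lambda>x. (D01 (D01 \<phi>) x)\<^sup>2)}"

definition norm_L22 :: "(real \<Rightarrow> real) \<Rightarrow> real" where
  "norm_L22 \<phi> = sqrt (\<integral>x. (D01 (D01 \<phi>) x)\<^sup>2 \<partial>lebesgue_on {0..1})"

definition error_functional ::
    "nat \<Rightarrow> real \<Rightarrow> (nat \<Rightarrow> real) \<Rightarrow> real \<Rightarrow> real \<Rightarrow> (real \<Rightarrow> real) \<Rightarrow> real" where
  "error_functional N h C A B \<phi> =
     (\<integral>x. \<phi> x \<partial>lebesgue_on {0..1}) - (\<Sum>\<beta>=0..N. C \<beta> * \<phi> (h * real \<beta>))
       - A * D01 \<phi> 0 - B * D01 \<phi> 1"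

text \<open>
  Extended-real valued: the norm is \<open>\<infinity>\<close> unless the formula is exact for all polynomials
  of degree at most 1.
\<close>

definition error_norm :: "nat \<Rightarrow> real \<Rightarrow> (nat \<Rightarrow> real) \<Rightarrow> real \<Rightarrow> real \<Rightarrow> ereal" where
  "error_norm N h C A B =
     (SUP \<phi>\<in>{\<phi>\<in>L22. norm_L22 \<phi> = 1}. ereal \<bar>error_functional N h C A B \<phi>\<bar>)"

definition optimal_formula :: "nat \<Rightarrow> real \<Rightarrow> (nat \<Rightarrow> real) \<Rightarrow> real \<Rightarrow> real \<Rightarrow> bool" where
  "optimal_formula N h C A B \<longleftrightarrow>
     error_norm N h C A B = (INF (C', A', B')\<in>UNIV. error_norm N h C' A' B')"

end

theory Submission
  imports Defs
begin

text \<open>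
  Let \<open>K = h\<^sup>2 B\<^sub>2(frac (x / h)) / 2\<close>, the periodic Bernoulli kernel, where \<open>B\<^sub>2\<close> is the second
  Bernoulli polynomial. Everything rests on two facts about \<open>K\<close>.
  
  The first gives the lower bound. \<open>K\<close> is the second derivative of the spline
  \<open>s(x) = h\<^sup>4 y\<^sup>2 (1 - y)\<^sup>2 / 24\<close>, \<open>y = frac (x / h)\<close>, which vanishes together with its derivative at
  every node. A quadrature sum therefore contributes nothing on \<open>s\<close>, so the error of \<^emph>\<open>every\<close> formula
  at \<open>s\<close> is \<open>\<integral>s = h\<^sup>4 / 720\<close> (\<open>error_functional_spline\<close>). As \<open>\<parallel>s\<parallel>\<^sup>2 = \<integral>K\<^sup>2\<close> has the same value, every
  error norm is at least \<open>h\<^sup>2 / sqrt 720\<close> (\<open>error_norm_ge\<close>).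
  
  The second gives the upper bound. The error of the trapezoid rule with the end corrections
  \<open>h\<^sup>2 / 12 (\<phi>'(0) - \<phi>'(1))\<close> is \<open>\<integral>K \<phi>''\<close> (\<open>trapezoid_kernel\<close>), and the inequality of Cauchy and Schwarz
  bounds it by \<open>h\<^sup>2 / sqrt 720\<close> times the norm of \<open>\<phi>\<close> (\<open>error_norm_trapezoid_le\<close>). Here \<open>\<phi>'\<close> is only
  absolutely continuous, so the integration by parts needs the fundamental theorem of calculus for
  such functions (\<open>fundamental_theorem_of_calculus_absolutely_continuous\<close>).
  
  For uniqueness, \<open>s\<close> is an extremal function of every optimal formula. Moving from \<open>s\<close> in the
  direction of a polynomial \<open>p\<close>, the first variation must vanish, which says that the error at \<open>p\<close> is
  \<open>\<integral>K p''\<close> (\<open>extremal_first_variation\<close>). Hence two optimal formulas have the same error on all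
  polynomials, and since point evaluations and derivatives at distinct nodes are linearly independent
  functionals on polynomials (\<open>hermite_functionals_independent\<close>), they have the same coefficients.
\<close>

section \<open>Absolutely continuous functions\<close>

text \<open>
  Absolute continuity is inherited by any function whose increments are controlled by those of an
  absolutely continuous function and of the identity. With \<open>F\<close> constant this covers Lipschitz
  functions; with \<open>F\<close> the derivative of a function in the Sobolev space it covers the products that
  integration by parts turns into a primitive.
\<close>
lemma absolutely_continuous_fun_on_dominated:
  assumes F: "absolutely_continuous_fun_on {a..b} F" and "C \<ge> 0"
    and dom: "\<And>u v. u \<in> {a..b} \<Longrightarrow> v \<in> {a..b} \<Longrightarrow>
      \<bar>G v - G u\<bar> \<le> C * (\<bar>v - u\<bar> + \<bar>F v - F u\<bar>)"
  shows "absolutely_continuous_fun_on {a..b} G"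
  unfolding absolutely_continuous_fun_on_def
proof (intro allI impI)
  fix e :: real assume "e > 0"
  define e' where "e' = e / (2 * (C + 1))"
  have "e' > 0" using \<open>e > 0\<close> \<open>C \<ge> 0\<close> by (simp add: e'_def)
  obtain \<delta> where "\<delta> > 0" and \<delta>: "\<And>d t. d division_of t \<Longrightarrow> t \<subseteq> {a..b} \<Longrightarrow>
      (\<Sum>k\<in>d. Sup k - Inf k) < \<delta> \<Longrightarrow> (\<Sum>k\<in>d. \<bar>F (Sup k) - F (Inf k)\<bar>) < e'"
    using F \<open>e' > 0\<close> unfolding absolutely_continuous_fun_on_def by meson
  show "\<exists>\<delta>>0. \<forall>d t. d division_of t \<and> t \<subseteq> {a..b} \<and> (\<Sum>k\<in>d. Sup k - Inf k) < \<delta> \<longrightarrow>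
      (\<Sum>k\<in>d. \<bar>G (Sup k) - G (Inf k)\<bar>) < e"
  proof (intro exI[of _ "min \<delta> e'"] conjI allI impI)
    show "min \<delta> e' > 0" using \<open>\<delta> > 0\<close> \<open>e' > 0\<close> by simp
    fix d t assume A: "d division_of t \<and> t \<subseteq> {a..b} \<and> (\<Sum>k\<in>d. Sup k - Inf k) < min \<delta> e'"
    have "\<bar>G (Sup k) - G (Inf k)\<bar> \<le> C * ((Sup k - Inf k) + \<bar>F (Sup k) - F (Inf k)\<bar>)" if "k \<in> d" for k
    proof -
      from A that obtain u v where k: "k = cbox u v" "k \<noteq> {}" "k \<subseteq> t"
        using division_ofD(2-4)[of d t k] by metis
      moreover have "k \<subseteq> {a..b}" using k A by blast
      ultimately have "u \<le> v" "u \<in> {a..b}" "v \<in> {a..b}" by auto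
      then show ?thesis using dom[of u v] k by auto
    qed
    then have "(\<Sum>k\<in>d. \<bar>G (Sup k) - G (Inf k)\<bar>)
        \<le> (\<Sum>k\<in>d. C * ((Sup k - Inf k) + \<bar>F (Sup k) - F (Inf k)\<bar>))"
      by (rule sum_mono)
    also have "\<dots> = C * ((\<Sum>k\<in>d. Sup k - Inf k) + (\<Sum>k\<in>d. \<bar>F (Sup k) - F (Inf k)\<bar>))"
      by (simp only: sum_distrib_left sum.distrib distrib_left)
    also have "\<dots> \<le> C * (e' + e')"
      using A \<delta>[of d t] \<open>C \<ge> 0\<close> by (intro mult_left_mono add_mono) auto
    also have "\<dots> < (C + 1) * (e' + e')"
      using \<open>e' > 0\<close> by (intro mult_strict_right_mono) auto
    also have "\<dots> = e" using \<open>C \<ge> 0\<close> by (simp add: e'_def divide_simps)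
    finally show "(\<Sum>k\<in>d. \<bar>G (Sup k) - G (Inf k)\<bar>) < e" .
  qed
qed

lemma lipschitz_imp_absolutely_continuous_fun_on:
  assumes "C \<ge> 0" and "\<And>u v. u \<in> {a..b} \<Longrightarrow> v \<in> {a..b} \<Longrightarrow> \<bar>G v - G u\<bar> \<le> C * \<bar>v - u\<bar>"
  shows "absolutely_continuous_fun_on {a..b} G"
proof (rule absolutely_continuous_fun_on_dominated[OF _ \<open>C \<ge> 0\<close>])
  show "absolutely_continuous_fun_on {a..b} (\<lambda>_. 0)"
    by (auto simp: absolutely_continuous_fun_on_def intro: exI[of _ 1])
qed (use assms in auto)

lemma absolutely_continuous_fun_on_subset:
  "absolutely_continuous_fun_on T F \<Longrightarrow> S \<subseteq> T \<Longrightarrow> absolutely_continuous_fun_on S F"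
  unfolding absolutely_continuous_fun_on_def by (meson order_trans)

lemma absolutely_continuous_fun_on_imp_continuous_on:
  assumes "absolutely_continuous_fun_on {a..b} F"
  shows "continuous_on {a..b} F"
  unfolding continuous_on_iff
proof (intro ballI allI impI)
  fix x e :: real assume x: "x \<in> {a..b}" and "e > 0"
  then obtain \<delta> where "\<delta> > 0" and \<delta>: "\<And>d t. d division_of t \<Longrightarrow> t \<subseteq> {a..b} \<Longrightarrow>
      (\<Sum>k\<in>d. Sup k - Inf k) < \<delta> \<Longrightarrow> (\<Sum>k\<in>d. \<bar>F (Sup k) - F (Inf k)\<bar>) < e"
    using assms unfolding absolutely_continuous_fun_on_def by meson
  have *: "\<bar>F v - F u\<bar> < e" if "u \<in> {a..b}" "v \<in> {a..b}" "u \<le> v" "v - u < \<delta>" for u v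
    using \<delta>[of "{{u..v}}" "{u..v}"] that division_of_self[of u v] by auto
  show "\<exists>d>0. \<forall>x'\<in>{a..b}. dist x' x < d \<longrightarrow> dist (F x') (F x) < e"
  proof (intro exI[of _ \<delta>] conjI ballI impI \<open>\<delta> > 0\<close>)
    fix y assume "y \<in> {a..b}" "dist y x < \<delta>"
    then show "dist (F y) (F x) < e"
      using *[of x y] *[of y x] x by (cases "x \<le> y") (auto simp: dist_real_def)
  qed
qed

text \<open>
  The intervals tagged by points of a null set are kept, by the choice of gauge, inside an open set of
  small measure. This turns that measure into a bound on the sum of lengths that absolute
  continuity speaks about.
\<close>
lemma sum_lengths_le_measure:
  fixes p :: "(real \<times> real set) set"
  assumes p: "p tagged_partial_division_of i" and sub: "\<And>x K. (x, K) \<in> p \<Longrightarrow> K \<subseteq> U"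
    and U: "U \<in> lmeasurable"
  shows "(\<Sum>K\<in>snd ` p. Sup K - Inf K) \<le> measure lebesgue U"
proof -
  have div: "snd ` p division_of \<Union>(snd ` p)"
    using division_of_tagged_division tagged_partial_division_of_Union_self[OF p] by blast
  have "(\<Sum>K\<in>snd ` p. Sup K - Inf K) = (\<Sum>K\<in>snd ` p. measure lebesgue K)"
  proof (rule sum.cong[OF refl])
    fix K assume "K \<in> snd ` p"
    then obtain u v where "K = cbox u v" "K \<noteq> {}" using division_ofD(3,4)[OF div] by metis
    then show "Sup K - Inf K = measure lebesgue K" by auto
  qed
  also have "\<dots> = measure lebesgue (\<Union>(snd ` p))" by (rule content_division[OF div])
  also have "\<dots> \<le> measure lebesgue U"
  proof (intro measure_mono_fmeasurable U)
    show "\<Union>(snd ` p) \<subseteq> U" using sub by fastforce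
    show "\<Union>(snd ` p) \<in> sets lebesgue" using lmeasurable_division[OF div] by (rule fmeasurableD)
  qed
  finally show ?thesis .
qed

text \<open>
  Absolute continuity sums over intervals, a gauge integral over tagged intervals. Two tags can share
  an interval only if it is degenerate, and such an interval has increment zero.
\<close>
lemma sum_increments_over_tags:
  fixes F :: "real \<Rightarrow> real"
  assumes p: "p tagged_partial_division_of i"
  shows "(\<Sum>(x,K)\<in>p. \<bar>F (Sup K) - F (Inf K)\<bar>) = (\<Sum>K\<in>snd ` p. \<bar>F (Sup K) - F (Inf K)\<bar>)"
proof -
  let ?d = "\<lambda>K. if K = {} then 0 else \<bar>F (Sup K) - F (Inf K)\<bar>"
  have ne: "K \<noteq> {}" if "(x, K) \<in> p" for x K
    using tagged_partial_division_ofD(2)[OF p that] by auto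
  have "(\<Sum>(x,K)\<in>p. ?d K) = (\<Sum>K\<in>snd ` p. ?d K)"
  proof (rule sum.over_tagged_division_lemma[OF tagged_partial_division_of_Union_self[OF p]])
    fix u v :: real assume "box u v = {}"
    then have "v \<le> u" by simp
    then show "?d (cbox u v) = 0" by (cases "u = v") auto
  qed
  moreover have "(\<Sum>(x,K)\<in>p. ?d K) = (\<Sum>(x,K)\<in>p. \<bar>F (Sup K) - F (Inf K)\<bar>)"
    using ne by (intro sum.cong) auto
  moreover have "(\<Sum>K\<in>snd ` p. ?d K) = (\<Sum>K\<in>snd ` p. \<bar>F (Sup K) - F (Inf K)\<bar>)"
    using ne by (intro sum.cong) auto
  ultimately show ?thesis by simp
qed

text \<open>
  The gauge is chosen differently on the two parts of the interval. At a tag outside \<open>S\<close>,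
  differentiability makes the increment of \<open>F\<close> over a short interval containing the tag nearly
  \<open>f x\<close> times the length, with an error proportional to the length. The intervals with tags in \<open>S\<close> lie
  in an open set of measure less than \<open>\<delta>\<close>, so absolute continuity makes their increments
  negligible in total, while the integrand may be taken to be zero there. Integrability of \<open>f\<close> is thus a
  conclusion.
\<close>
lemma fundamental_theorem_of_calculus_absolutely_continuous:
  fixes F f :: "real \<Rightarrow> real"
  assumes "a \<le> b" and AC: "absolutely_continuous_fun_on {a..b} F" and S: "negligible S"
    and der: "\<And>x. x \<in> {a..b} - S \<Longrightarrow> (F has_vector_derivative f x) (at x within {a..b})"
  shows "(f has_integral (F b - F a)) {a..b}"
proof -
  \<comment> \<open>On a null set the integrand may be changed freely; with value zero the tags in \<open>S\<close> contribute nothing.\<close>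
  define g where "g x = (if x \<in> S then 0 else f x)" for x
  have "(g has_integral (F b - F a)) {a..b}"
    unfolding has_integral_real
  proof (intro allI impI)
    fix e :: real assume "e > 0"
    define e' where "e' = e / (2 * (b - a + 1))"
    have "e' > 0" using \<open>e > 0\<close> \<open>a \<le> b\<close> by (simp add: e'_def)
    obtain \<delta> where "\<delta> > 0" and \<delta>: "\<And>d t. d division_of t \<Longrightarrow> t \<subseteq> {a..b} \<Longrightarrow>
        (\<Sum>k\<in>d. Sup k - Inf k) < \<delta> \<Longrightarrow> (\<Sum>k\<in>d. \<bar>F (Sup k) - F (Inf k)\<bar>) < e / 2"
      using AC \<open>e > 0\<close> unfolding absolutely_continuous_fun_on_def by (meson half_gt_zero)
    obtain U where U: "open U" "S \<subseteq> U" "U \<in> lmeasurable" "measure lebesgue U < \<delta>"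
    proof -
      have "S \<in> null_sets lebesgue" using S negligible_iff_null_sets by blast
      then obtain T where T: "open T" "S \<subseteq> T" "T - S \<in> lmeasurable" "emeasure lebesgue (T - S) < ennreal \<delta>"
        using sets_lebesgue_outer_open[OF _ \<open>\<delta> > 0\<close>] by blast
      have "T - S \<union> S = T" using T by auto
      have "T \<in> lmeasurable"
        using T(3) fmeasurable.Un[OF T(3) negligible_imp_measurable[OF S]] \<open>T - S \<union> S = T\<close> by simp
      moreover have "measure lebesgue T = measure lebesgue (T - S)"
        using S \<open>T \<in> lmeasurable\<close> measure_Diff_null_set
          \<open>S \<in> null_sets lebesgue\<close> by (metis fmeasurableD)
      moreover have "measure lebesgue (T - S) < \<delta>"
        using T(3,4) \<open>\<delta> > 0\<close> by (simp add: emeasure_eq_measure2 ennreal_less_iff)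
      ultimately show ?thesis using that T by metis
    qed
    have "\<exists>r>0. x \<in> {a..b} \<longrightarrow>
        (\<forall>y\<in>{a..b}. \<bar>y - x\<bar> < r \<longrightarrow> \<bar>F y - F x - (y - x) * f x\<bar> \<le> e' * \<bar>y - x\<bar>)" if "x \<notin> S" for x
    proof (cases "x \<in> {a..b}")
      case True
      then show ?thesis
        using der[of x] that \<open>e' > 0\<close>
        unfolding has_vector_derivative_def has_derivative_within_alt by auto
    qed (auto intro: exI[of _ 1])
    then obtain r where r: "\<And>x. x \<notin> S \<Longrightarrow> r x > 0"
      "\<And>x y. x \<notin> S \<Longrightarrow> x \<in> {a..b} \<Longrightarrow> y \<in> {a..b} \<Longrightarrow> \<bar>y - x\<bar> < r x \<Longrightarrow>
        \<bar>F y - F x - (y - x) * f x\<bar> \<le> e' * \<bar>y - x\<bar>" by metis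
    define \<gamma> where "\<gamma> x = (if x \<in> S then U else ball x (r x))" for x
    show "\<exists>\<gamma>. gauge \<gamma> \<and> (\<forall>p. p tagged_division_of {a..b} \<and> \<gamma> fine p \<longrightarrow>
        norm ((\<Sum>(x,K)\<in>p. measure lborel K *\<^sub>R g x) - (F b - F a)) < e)"
    proof (intro exI[of _ \<gamma>] conjI allI impI)
      show "gauge \<gamma>" using U r(1) by (auto simp: gauge_def \<gamma>_def)
      fix p assume p': "p tagged_division_of {a..b} \<and> \<gamma> fine p"
      then have p: "p tagged_division_of {a..b}" and fine: "\<gamma> fine p" by auto
      define p1 where "p1 = {(x,K). (x,K) \<in> p \<and> x \<notin> S}"
      define p2 where "p2 = {(x,K). (x,K) \<in> p \<and> x \<in> S}"
      let ?D = "\<lambda>(x,K). \<bar>measure lborel K * g x - (F (Sup K) - F (Inf K))\<bar>"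
      have fin: "finite p" using p by blast
      have p12: "p = p1 \<union> p2" "p1 \<inter> p2 = {}" "finite p1" "finite p2"
        by (auto simp: p1_def p2_def intro: finite_subset[OF _ fin])
      have "?D xk \<le> (case xk of (x,K) \<Rightarrow> e' * measure lborel K)" if "xk \<in> p1" for xk
      proof -
        obtain x K where xk: "xk = (x,K)" by force
        with that have xK: "(x,K) \<in> p" "x \<notin> S" by (auto simp: p1_def)
        then obtain u v where K: "K = cbox u v" "x \<in> K" "K \<subseteq> {a..b}"
          using tagged_division_ofD(2-4)[OF p] by metis
        have "K \<subseteq> ball x (r x)" using fine xK by (fastforce simp: fine_def \<gamma>_def)
        moreover have "u \<in> K" "v \<in> K" using K by auto
        ultimately have "dist x u < r x" "dist x v < r x" by auto
        then have "\<bar>u - x\<bar> < r x" "\<bar>v - x\<bar> < r x" by (auto simp: dist_real_def)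
        moreover have uv: "u \<le> x" "x \<le> v" "u \<in> {a..b}" "v \<in> {a..b}" using K by auto
        ultimately have "\<bar>F u - F x - (u - x) * f x\<bar> \<le> e' * (x - u)"
            "\<bar>F v - F x - (v - x) * f x\<bar> \<le> e' * (v - x)"
          using r(2)[of x u] r(2)[of x v] xK(2) K by auto
        then have "\<bar>(v - u) * f x - (F v - F u)\<bar> \<le> e' * (v - u)"
          by (simp add: algebra_simps abs_le_iff)
        then show ?thesis using uv K xK(2) by (simp add: xk g_def)
      qed
      then have "sum ?D p1 \<le> (\<Sum>(x,K)\<in>p1. e' * measure lborel K)" by (rule sum_mono)
      also have "\<dots> \<le> (\<Sum>(x,K)\<in>p. e' * measure lborel K)"
        using fin p12 \<open>e' > 0\<close> by (intro sum_mono2) auto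
      also have "\<dots> = e' * (\<Sum>(x,K)\<in>p. measure lborel K)"
        by (simp add: sum_distrib_left case_prod_unfold)
      also have "\<dots> = e' * (b - a)"
        using additive_content_tagged_division[of p a b] p \<open>a \<le> b\<close> by simp
      also have "\<dots> < e / 2"
        using \<open>e > 0\<close> \<open>a \<le> b\<close> by (simp add: e'_def field_simps)
      finally have s1: "sum ?D p1 < e / 2" .
      have part: "p2 tagged_partial_division_of {a..b}"
        using p p12 by (meson Un_upper2 tagged_division_of_def tagged_partial_division_subset)
      have "sum ?D p2 = (\<Sum>(x,K)\<in>p2. \<bar>F (Sup K) - F (Inf K)\<bar>)"
        by (rule sum.cong) (auto simp: p2_def g_def)
      also have "\<dots> = (\<Sum>K\<in>snd ` p2. \<bar>F (Sup K) - F (Inf K)\<bar>)"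
        by (rule sum_increments_over_tags[OF part])
      also have "\<dots> < e / 2"
      proof (rule \<delta>)
        show "snd ` p2 division_of \<Union>(snd ` p2)"
          using division_of_tagged_division tagged_partial_division_of_Union_self[OF part] by blast
        show "\<Union>(snd ` p2) \<subseteq> {a..b}"
          using tagged_partial_division_ofD(3)[OF part] by (simp add: UN_subset_iff split_beta) force
        have sub: "K \<subseteq> U" if "(x,K) \<in> p2" for x K
          using that fineD[OF fine, of x K] by (auto simp: p2_def \<gamma>_def)
        have "(\<Sum>K\<in>snd ` p2. Sup K - Inf K) \<le> measure lebesgue U"
          using sub U(3) by (rule sum_lengths_le_measure[OF part])
        then show "(\<Sum>K\<in>snd ` p2. Sup K - Inf K) < \<delta>" using U(4) by linarith
      qed
      finally have s2: "sum ?D p2 < e / 2" .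
      have "(\<Sum>(x,K)\<in>p. measure lborel K *\<^sub>R g x) - (F b - F a)
          = (\<Sum>(x,K)\<in>p. measure lborel K * g x - (F (Sup K) - F (Inf K)))"
        using additive_tagged_division_1[OF \<open>a \<le> b\<close> p, of F]
        by (simp add: sum_subtractf case_prod_unfold)
      also have "\<bar>\<dots>\<bar> \<le> sum ?D p"
        by (rule order_trans[OF sum_abs]) (simp add: case_prod_unfold)
      also have "\<dots> = sum ?D p1 + sum ?D p2"
        unfolding p12(1) using p12 by (intro sum.union_disjoint) auto
      also have "\<dots> < e" using s1 s2 by simp
      finally show "norm ((\<Sum>(x,K)\<in>p. measure lborel K *\<^sub>R g x) - (F b - F a)) < e" by simp
    qed
  qed
  then show ?thesis
    by (rule has_integral_spike[OF S, rotated]) (auto simp: g_def)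
qed

section \<open>The corrected trapezoid rule on one cell\<close>

lemma continuous_on_Icc_abs_bound:
  fixes f :: "real \<Rightarrow> real"
  assumes "continuous_on {a..b} f"
  obtains M where "M \<ge> 0" "\<And>x. x \<in> {a..b} \<Longrightarrow> \<bar>f x\<bar> \<le> M"
proof -
  have "bounded (f ` {a..b})"
    using compact_continuous_image[OF assms] compact_Icc compact_imp_bounded by blast
  then obtain M where "M > 0" "\<And>x. x \<in> {a..b} \<Longrightarrow> \<bar>f x\<bar> \<le> M"
    unfolding bounded_pos by auto
  then show ?thesis using that[of M] by auto
qed

lemma abs_diff_le_derivative_bound:
  fixes f f' :: "real \<Rightarrow> real"
  assumes "\<And>x. x \<in> {a..b} \<Longrightarrow> (f has_vector_derivative f' x) (at x within {a..b})"
    and "\<And>x. x \<in> {a..b} \<Longrightarrow> \<bar>f' x\<bar> \<le> M" and "u \<in> {a..b}" "v \<in> {a..b}"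
  shows "\<bar>f v - f u\<bar> \<le> M * \<bar>v - u\<bar>"
  using field_differentiable_bound[of "{a..b}" f f' M v u] assms
  by (simp add: has_real_derivative_iff_has_vector_derivative)

text \<open>
  Integration by parts, twice, against the quadratic \<open>k\<close> with \<open>k'' = 1\<close>: the function
  \<open>k' \<phi> - k \<phi>'\<close> is a primitive of \<open>\<phi> - k f\<close>. The slope of \<open>k\<close> is chosen so that
  \<open>k'(b) = - k'(a) = (b - a) / 2\<close>, which produces the trapezoid rule, and its constant term so that \<open>k\<close>
  has mean zero on \<open>[a, b]\<close>. By symmetry \<open>k\<close> is then orthogonal to all polynomials of degree at most
  one, so that it has the least \<open>L\<^sub>2\<close> norm among quadratics with this leading term.
\<close>
lemma trapezoid_cell:
  fixes a b :: real and \<phi> \<phi>1 f :: "real \<Rightarrow> real"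
  defines "k \<equiv> \<lambda>x. (x - a)\<^sup>2 / 2 - (b - a) / 2 * (x - a) + (b - a)\<^sup>2 / 12"
  assumes "a \<le> b"
    and d\<phi>: "\<And>x. x \<in> {a..b} \<Longrightarrow> (\<phi> has_vector_derivative \<phi>1 x) (at x within {a..b})"
    and AC: "absolutely_continuous_fun_on {a..b} \<phi>1" and S: "negligible S"
    and d\<phi>1: "\<And>x. x \<in> {a..b} - S \<Longrightarrow> (\<phi>1 has_vector_derivative f x) (at x within {a..b})"
  shows "((\<lambda>x. \<phi> x - k x * f x) has_integral
      ((b - a) / 2 * (\<phi> a + \<phi> b) + (b - a)\<^sup>2 / 12 * (\<phi>1 a - \<phi>1 b))) {a..b}"
proof -
  define k1 where "k1 = (\<lambda>x. (x - a) - (b - a) / 2)"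
  define \<Phi> where "\<Phi> = (\<lambda>x. k1 x * \<phi> x - k x * \<phi>1 x)"
  have dk: "(k has_vector_derivative k1 x) (at x within {a..b})" for x
    unfolding k_def k1_def has_real_derivative_iff_has_vector_derivative[symmetric]
    by (auto intro!: derivative_eq_intros simp: field_simps)
  have dk1: "(k1 has_vector_derivative 1) (at x within {a..b})" for x
    unfolding k1_def has_real_derivative_iff_has_vector_derivative[symmetric]
    by (auto intro!: derivative_eq_intros)
  have "continuous_on {a..b} \<phi>" "continuous_on {a..b} k" "continuous_on {a..b} k1"
    by (rule continuous_on_vector_derivative, rule d\<phi> dk dk1, assumption?)+
  moreover have "continuous_on {a..b} \<phi>1"
    by (rule absolutely_continuous_fun_on_imp_continuous_on[OF AC])
  ultimately have "continuous_on {a..b} (\<lambda>x. \<bar>\<phi> x\<bar> + \<bar>k x\<bar> + \<bar>k1 x\<bar> + \<bar>\<phi>1 x\<bar>)"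
    by (intro continuous_intros)
  then obtain M where "M \<ge> 0" and "\<And>x. x \<in> {a..b} \<Longrightarrow> \<bar>\<bar>\<phi> x\<bar> + \<bar>k x\<bar> + \<bar>k1 x\<bar> + \<bar>\<phi>1 x\<bar>\<bar> \<le> M"
    using continuous_on_Icc_abs_bound by blast
  then have M: "\<bar>\<phi> x\<bar> \<le> M" "\<bar>k x\<bar> \<le> M" "\<bar>k1 x\<bar> \<le> M" "\<bar>\<phi>1 x\<bar> \<le> M" if "x \<in> {a..b}" for x
    using that by (smt (verit))+
  have "absolutely_continuous_fun_on {a..b} \<Phi>"
  proof (rule absolutely_continuous_fun_on_dominated[OF AC])
    show "2 * M * M + M \<ge> 0" using \<open>M \<ge> 0\<close> by simp
    fix u v assume uv: "u \<in> {a..b}" "v \<in> {a..b}"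
    have 1: "\<bar>\<phi> v - \<phi> u\<bar> \<le> M * \<bar>v - u\<bar>" "\<bar>k v - k u\<bar> \<le> M * \<bar>v - u\<bar>" "\<bar>k1 v - k1 u\<bar> \<le> 1 * \<bar>v - u\<bar>"
      using uv M by (auto intro!: abs_diff_le_derivative_bound[OF d\<phi>]
          abs_diff_le_derivative_bound[OF dk] simp: k1_def)
    \<comment> \<open>Increments of a product, split so that each factor is bounded by \<open>M\<close>.\<close>
    have "\<Phi> v - \<Phi> u = k1 v * (\<phi> v - \<phi> u) + \<phi> u * (k1 v - k1 u)
        - (k v * (\<phi>1 v - \<phi>1 u) + \<phi>1 u * (k v - k u))"
      by (simp add: \<Phi>_def algebra_simps)
    also have "\<bar>\<dots>\<bar> \<le> \<bar>k1 v\<bar> * \<bar>\<phi> v - \<phi> u\<bar> + \<bar>\<phi> u\<bar> * \<bar>k1 v - k1 u\<bar>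
        + (\<bar>k v\<bar> * \<bar>\<phi>1 v - \<phi>1 u\<bar> + \<bar>\<phi>1 u\<bar> * \<bar>k v - k u\<bar>)"
      unfolding abs_mult[symmetric] by linarith
    also have "\<dots> \<le> M * (M * \<bar>v - u\<bar>) + M * (1 * \<bar>v - u\<bar>)
        + (M * \<bar>\<phi>1 v - \<phi>1 u\<bar> + M * (M * \<bar>v - u\<bar>))"
      by (intro add_mono mult_mono[OF M(3)] mult_mono[OF M(1)] mult_mono[OF M(2)] mult_mono[OF M(4)]
          uv 1 order_refl \<open>M \<ge> 0\<close> abs_ge_zero)
    also have "\<dots> \<le> (2 * M * M + M) * (\<bar>v - u\<bar> + \<bar>\<phi>1 v - \<phi>1 u\<bar>)"
      using \<open>M \<ge> 0\<close> by (simp add: algebra_simps)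
    finally show "\<bar>\<Phi> v - \<Phi> u\<bar> \<le> (2 * M * M + M) * (\<bar>v - u\<bar> + \<bar>\<phi>1 v - \<phi>1 u\<bar>)" .
  qed
  moreover have "(\<Phi> has_vector_derivative (\<phi> x - k x * f x)) (at x within {a..b})"
    if "x \<in> {a..b} - S" for x
  proof -
    have "(\<Phi> has_vector_derivative ((k1 x * \<phi>1 x + 1 * \<phi> x) - (k x * f x + k1 x * \<phi>1 x)))
        (at x within {a..b})"
      unfolding \<Phi>_def using that
      by (intro has_vector_derivative_diff has_vector_derivative_mult d\<phi> d\<phi>1 dk dk1) auto
    then show ?thesis by simp
  qed
  ultimately have "((\<lambda>x. \<phi> x - k x * f x) has_integral (\<Phi> b - \<Phi> a)) {a..b}"
    using \<open>a \<le> b\<close> S by (intro fundamental_theorem_of_calculus_absolutely_continuous)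
  moreover have "\<Phi> b - \<Phi> a = (b - a) / 2 * (\<phi> a + \<phi> b) + (b - a)\<^sup>2 / 12 * (\<phi>1 a - \<phi>1 b)"
    by (simp add: \<Phi>_def k_def k1_def field_simps power2_eq_square)
  ultimately show ?thesis by simp
qed

section \<open>Composition with the fractional part\<close>

lemma has_integral_cells:
  fixes g :: "real \<Rightarrow> real"
  assumes "h \<ge> 0" and "\<And>n. n < m \<Longrightarrow> (g has_integral I n) {h * real n..h * real (Suc n)}"
  shows "(g has_integral (\<Sum>n<m. I n)) {0..h * real m}"
  using assms(2)
proof (induction m)
  case (Suc m)
  have "(g has_integral (\<Sum>n<m. I n) + I m) {0..h * real (Suc m)}"
    using Suc \<open>h \<ge> 0\<close>
    by (intro has_integral_combine[where c = "h * real m"]) (auto intro: mult_left_mono)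
  then show ?case by simp
qed auto

text \<open>
  The case to watch is the right end of the cell: there \<open>frac y = 0\<close> but \<open>y - of_int n = 1\<close>, and
  \<open>P 0 = P 1\<close> closes the gap. Including both ends makes the identity usable on the closed cells over
  which one integrates.
\<close>
lemma periodic_eq_translate:
  fixes P :: "real \<Rightarrow> real"
  assumes "P 0 = P 1" "of_int n \<le> y" "y \<le> of_int n + 1"
  shows "P (frac y) = P (y - of_int n)"
proof (cases "y = of_int n + 1")
  case True
  moreover have "frac y = 0" unfolding True frac_eq_0_iff by simp
  ultimately show ?thesis by (simp only: assms(1) add_diff_cancel_left')
next
  case False
  then have "\<lfloor>y\<rfloor> = n" using assms by (intro floor_unique) auto
  then show ?thesis by (simp add: frac_def)
qed

lemma frac_on_cell:
  fixes P :: "real \<Rightarrow> real"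
  assumes "P 0 = P 1" and "h > 0" and "x \<in> {h * real n..h * real (Suc n)}"
  shows "P (frac (x / h)) = P (x / h - real n)"
  using periodic_eq_translate[of P "int n" "x / h"] assms by (auto simp: field_simps)

lemma has_integral_periodic_cells:
  assumes G: "\<And>y. (G has_real_derivative g y) (at y)" and "g 0 = g 1" and "h > 0"
  shows "((\<lambda>x. g (frac (x / h))) has_integral real m * (h * (G 1 - G 0))) {0..h * real m}"
proof -
  have "((\<lambda>x. g (frac (x / h))) has_integral (h * (G 1 - G 0))) {h * real n..h * real (Suc n)}" for n
  proof -
    have "((\<lambda>x. g (x / h - real n)) has_integral
        (h * G (h * real (Suc n) / h - real n) - h * G (h * real n / h - real n)))
        {h * real n..h * real (Suc n)}"
    proof (rule fundamental_theorem_of_calculus)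
      show "h * real n \<le> h * real (Suc n)" using \<open>h > 0\<close> by simp
      show "((\<lambda>x. h * G (x / h - real n)) has_vector_derivative g (x / h - real n))
          (at x within {h * real n..h * real (Suc n)})" for x
        unfolding has_real_derivative_iff_has_vector_derivative[symmetric]
        using \<open>h > 0\<close>
        by (auto intro!: derivative_eq_intros DERIV_chain2[OF has_field_derivative_at_within[OF G]])
    qed
    moreover have "h * real (Suc n) / h - real n = 1" "h * real n / h - real n = 0"
      using \<open>h > 0\<close> by (auto simp: field_simps)
    ultimately have "((\<lambda>x. g (x / h - real n)) has_integral (h * (G 1 - G 0)))
        {h * real n..h * real (Suc n)}" by (simp only: right_diff_distrib)
    then show ?thesis
      by (rule has_integral_eq[rotated]) (use frac_on_cell[of g h _ n] assms(2,3) in auto)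
  qed
  from has_integral_cells[OF less_imp_le[OF \<open>h > 0\<close>], of m _ "\<lambda>_. h * (G 1 - G 0)"] this
  show ?thesis by simp
qed

text \<open>
  At an integer \<open>x\<close> the cells to the left and to the right differ, elsewhere they are the same; treating
  the two sides separately covers both situations. The integers do not depend on \<open>P\<close>, so that a
  function and its derivative can be translated together.
\<close>
lemma periodic_one_sided_translates:
  fixes x :: real
  obtains m n :: int and d :: real where "d > 0"
    "\<And>P y. P 0 = P (1::real) \<Longrightarrow> y \<in> {..x} \<Longrightarrow> dist y x < d \<Longrightarrow> P (y - of_int m) = (P (frac y) :: real)"
    "\<And>P y. P 0 = P (1::real) \<Longrightarrow> y \<in> {x..} \<Longrightarrow> dist y x < d \<Longrightarrow> P (y - of_int n) = (P (frac y) :: real)"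
proof
  \<comment> \<open>On the left \<open>\<lceil>x\<rceil> - 1\<close> instead of \<open>\<lfloor>x\<rfloor>\<close>, so that the left cell reaches below \<open>x\<close> also for integer \<open>x\<close>.\<close>
  define m n where "m = \<lceil>x\<rceil> - 1" and "n = \<lfloor>x\<rfloor>"
  have mn: "of_int m < x" "x \<le> of_int m + 1" "of_int n \<le> x" "x < of_int n + 1"
    unfolding m_def n_def by linarith+
  define d where "d = min (x - of_int m) (of_int n + 1 - x)"
  show "d > 0" using mn by (simp add: d_def)
  show "P (y - of_int m) = P (frac y)"
    if "P 0 = P (1::real)" "y \<in> {..x}" "dist y x < d" for P :: "real \<Rightarrow> real" and y
    using that mn periodic_eq_translate[of P m y] by (auto simp: d_def dist_real_def)
  show "P (y - of_int n) = P (frac y)"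
    if "P 0 = P (1::real)" "y \<in> {x..}" "dist y x < d" for P :: "real \<Rightarrow> real" and y
    using that mn periodic_eq_translate[of P n y] by (auto simp: d_def dist_real_def)
qed

lemma at_within_two_sides: "at (x::real) within ({..x} \<union> {x..}) = at x"
proof -
  have "{..x} \<union> {x..} = UNIV" by auto
  then show ?thesis by simp
qed

lemma continuous_periodic:
  fixes P :: "real \<Rightarrow> real"
  assumes "continuous_on UNIV P" and "P 0 = P 1"
  shows "continuous_on UNIV (\<lambda>y. P (frac y))"
proof (rule continuous_at_imp_continuous_on, rule ballI)
  fix x :: real
  obtain m n :: int and d where "d > 0"
    and L: "\<And>y. y \<in> {..x} \<Longrightarrow> dist y x < d \<Longrightarrow> P (y - of_int m) = P (frac y)"
    and R: "\<And>y. y \<in> {x..} \<Longrightarrow> dist y x < d \<Longrightarrow> P (y - of_int n) = P (frac y)"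
    using periodic_one_sided_translates[of x] assms(2) by metis
  have cont: "continuous (at x within T) (\<lambda>y. P (y - of_int k))" for T and k :: int
  proof (rule continuous_at_imp_continuous_at_within, rule isCont_o2[where g = P and f = "\<lambda>y. y - of_int k"])
    show "isCont (\<lambda>y. y - of_int k) x" by (intro continuous_intros)
    show "isCont P (x - of_int k)" using assms(1) by (simp add: continuous_on_eq_continuous_at)
  qed
  have "continuous (at x within {..x}) (\<lambda>y. P (frac y))"
    by (rule continuous_transform_within[OF cont \<open>d > 0\<close> _ L]) simp_all
  moreover have "continuous (at x within {x..}) (\<lambda>y. P (frac y))"
    by (rule continuous_transform_within[OF cont \<open>d > 0\<close> _ R]) simp_all
  ultimately have "continuous (at x within ({..x} \<union> {x..})) (\<lambda>y. P (frac y))"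
    by (simp only: continuous_within Lim_within_Un)
  then show "isCont (\<lambda>y. P (frac y)) x" by (simp only: at_within_two_sides)
qed

lemma has_real_derivative_periodic:
  fixes P P' :: "real \<Rightarrow> real"
  assumes P: "\<And>y. (P has_real_derivative P' y) (at y)" and "P 0 = P 1" "P' 0 = P' 1"
  shows "((\<lambda>y. P (frac y)) has_real_derivative P' (frac x)) (at x)"
proof -
  obtain m n :: int and d where "d > 0"
    and L: "\<And>Q y. Q 0 = Q (1::real) \<Longrightarrow> y \<in> {..x} \<Longrightarrow> dist y x < d \<Longrightarrow> Q (y - of_int m) = (Q (frac y) :: real)"
    and R: "\<And>Q y. Q 0 = Q (1::real) \<Longrightarrow> y \<in> {x..} \<Longrightarrow> dist y x < d \<Longrightarrow> Q (y - of_int n) = (Q (frac y) :: real)"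
    using periodic_one_sided_translates[of x] by metis
  have der: "((\<lambda>y. P (y - of_int k)) has_real_derivative P' (x - of_int k)) (at x within T)" for T and k :: int
    by (rule DERIV_chain2[OF P, where Db = 1, simplified]) (auto intro!: derivative_eq_intros)
  have "((\<lambda>y. P (frac y)) has_real_derivative P' (x - of_int m)) (at x within {..x})"
    by (rule has_field_derivative_transform_within[OF der \<open>d > 0\<close>]) (auto intro!: L assms(2))
  moreover have "((\<lambda>y. P (frac y)) has_real_derivative P' (x - of_int n)) (at x within {x..})"
    by (rule has_field_derivative_transform_within[OF der \<open>d > 0\<close>]) (auto intro!: R assms(2))
  moreover have "P' (x - of_int m) = P' (frac x)" "P' (x - of_int n) = P' (frac x)"
    using L[of P' x] R[of P' x] assms(3) \<open>d > 0\<close> by auto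
  ultimately have "((\<lambda>y. P (frac y)) has_real_derivative P' (frac x)) (at x within ({..x} \<union> {x..}))"
    by (simp only: has_field_derivative_iff Lim_within_Un)
  then show ?thesis by (simp only: at_within_two_sides)
qed

section \<open>Twice continuously differentiable test functions\<close>

text \<open>
  Lower bounds for an error norm only need such smooth test functions. The derivatives are carried
  along explicitly, which keeps the one-sided derivatives in \<^const>\<open>D01\<close> out of the calculations.
\<close>
definition twice_cont_diff :: "(real \<Rightarrow> real) \<Rightarrow> (real \<Rightarrow> real) \<Rightarrow> (real \<Rightarrow> real) \<Rightarrow> bool" where
  "twice_cont_diff \<phi> \<phi>1 \<phi>2 \<longleftrightarrow>
     (\<forall>x. (\<phi> has_real_derivative \<phi>1 x) (at x)) \<and> (\<forall>x. (\<phi>1 has_real_derivative \<phi>2 x) (at x)) \<and>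
     continuous_on UNIV \<phi>2"

lemma twice_cont_diff_add_scaled:
  assumes "twice_cont_diff \<phi> \<phi>1 \<phi>2" and "twice_cont_diff \<psi> \<psi>1 \<psi>2"
  shows "twice_cont_diff (\<lambda>x. \<phi> x + t * \<psi> x) (\<lambda>x. \<phi>1 x + t * \<psi>1 x) (\<lambda>x. \<phi>2 x + t * \<psi>2 x)"
  using assms unfolding twice_cont_diff_def
  by (auto intro!: continuous_intros derivative_eq_intros)

lemma twice_cont_diff_poly:
  "twice_cont_diff (poly p) (poly (pderiv p)) (poly (pderiv (pderiv p)))"
  unfolding twice_cont_diff_def by (auto intro!: continuous_intros)

lemma twice_cont_diff_continuous_on:
  assumes "twice_cont_diff \<phi> \<phi>1 \<phi>2"
  shows "continuous_on S \<phi>" "continuous_on S \<phi>2"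
proof -
  show "continuous_on S \<phi>"
    using assms unfolding twice_cont_diff_def
    by (meson DERIV_isCont continuous_at_imp_continuous_on)
  show "continuous_on S \<phi>2"
    using assms unfolding twice_cont_diff_def by (meson continuous_on_subset subset_UNIV)
qed

lemma D01_eqI:
  assumes "(f has_real_derivative d) (at x)" and "x \<in> {0..1}"
    and "\<And>y. y \<in> {0..1} \<Longrightarrow> g y = f y"
  shows "D01 g x = d" and "(g has_vector_derivative d) (at x within {0..1})"
proof -
  have "(f has_vector_derivative d) (at x within {0..1})"
    using assms(1) has_real_derivative_iff_has_vector_derivative has_vector_derivative_at_within by blast
  then show "(g has_vector_derivative d) (at x within {0..1})"
    using assms(2,3) has_vector_derivative_transform by blast
  then show "D01 g x = d" unfolding D01_def
    using vector_derivative_within_cbox[of 0 1 x g d] assms(2) by simp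
qed

lemma twice_cont_diff_D01:
  assumes "twice_cont_diff \<phi> \<phi>1 \<phi>2" and "x \<in> {0..1}"
  shows "D01 \<phi> x = \<phi>1 x" and "D01 (D01 \<phi>) x = \<phi>2 x"
    and "(D01 \<phi> has_vector_derivative \<phi>2 x) (at x within {0..1})"
proof -
  have *: "D01 \<phi> y = \<phi>1 y" if "y \<in> {0..1}" for y
    using D01_eqI(1)[of \<phi> "\<phi>1 y" y \<phi>] assms that unfolding twice_cont_diff_def by blast
  show "D01 \<phi> x = \<phi>1 x" using * assms by blast
  show "D01 (D01 \<phi>) x = \<phi>2 x" "(D01 \<phi> has_vector_derivative \<phi>2 x) (at x within {0..1})"
    using D01_eqI[of \<phi>1 "\<phi>2 x" x "D01 \<phi>"] * assms unfolding twice_cont_diff_def by blast+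
qed

lemma twice_cont_diff_L22:
  assumes \<phi>: "twice_cont_diff \<phi> \<phi>1 \<phi>2"
  shows "\<phi> \<in> L22" and "norm_L22 \<phi> = sqrt (integral {0..1} (\<lambda>x. (\<phi>2 x)\<^sup>2))"
proof -
  note D = twice_cont_diff_D01[OF \<phi>]
  have cont: "continuous_on {0..1} \<phi>2" by (rule twice_cont_diff_continuous_on(2)[OF \<phi>])
  have cong: "f \<in> borel_measurable (lebesgue_on {0..1})"
    if "\<And>x. x \<in> {0..1} \<Longrightarrow> f x = g x" "continuous_on {0..1} g" for f g :: "real \<Rightarrow> real"
    using measurable_cong[of "lebesgue_on {0..1}" f g borel] that
      continuous_imp_measurable_on_sets_lebesgue[of "{0..1}" g] by auto
  have int: "integrable (lebesgue_on {0..1}) (\<lambda>x. (\<phi>2 x)\<^sup>2)"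
    using cont by (intro continuous_imp_integrable_real continuous_intros)
  obtain M where M: "M \<ge> 0" "\<And>x. x \<in> {0..1} \<Longrightarrow> \<bar>\<phi>2 x\<bar> \<le> M"
    using continuous_on_Icc_abs_bound[OF cont] by blast
  have "\<phi> differentiable_on {0..1}"
    using \<phi> unfolding twice_cont_diff_def differentiable_on_def
    by (meson differentiable_at_withinI real_differentiable_def)
  moreover have "absolutely_continuous_fun_on {0..1} (D01 \<phi>)"
    by (rule lipschitz_imp_absolutely_continuous_fun_on[OF M(1)
          abs_diff_le_derivative_bound[of 0 1 "D01 \<phi>" \<phi>2 M]]) (use D M in auto)
  moreover have "AE x in lebesgue_on {0..1}. D01 \<phi> differentiable (at x within {0..1})"
    by (rule AE_I2) (use D(3) in \<open>auto intro: differentiableI_vector\<close>)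
  moreover have "D01 (D01 \<phi>) \<in> borel_measurable (lebesgue_on {0..1})"
    using cong[OF D(2) cont] .
  moreover have "integrable (lebesgue_on {0..1}) (\<lambda>x. (D01 (D01 \<phi>) x)\<^sup>2)"
    using int D(2) by (subst Bochner_Integration.integrable_cong[OF refl, where g = "\<lambda>x. (\<phi>2 x)\<^sup>2"]) auto
  ultimately show "\<phi> \<in> L22" unfolding L22_def by blast
  have "(\<integral>x. (D01 (D01 \<phi>) x)\<^sup>2 \<partial>lebesgue_on {0..1}) = (\<integral>x. (\<phi>2 x)\<^sup>2 \<partial>lebesgue_on {0..1})"
    using D(2) by (intro Bochner_Integration.integral_cong) auto
  also have "\<dots> = integral {0..1} (\<lambda>x. (\<phi>2 x)\<^sup>2)"
    by (rule lebesgue_integral_eq_integral[OF int]) auto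
  finally show "norm_L22 \<phi> = sqrt (integral {0..1} (\<lambda>x. (\<phi>2 x)\<^sup>2))" by (simp add: norm_L22_def)
qed

lemma error_functional_twice_cont_diff:
  assumes \<phi>: "twice_cont_diff \<phi> \<phi>1 \<phi>2"
  shows "error_functional N h C A B \<phi> = integral {0..1} \<phi> - (\<Sum>\<beta>=0..N. C \<beta> * \<phi> (h * real \<beta>))
     - A * \<phi>1 0 - B * \<phi>1 1"
  unfolding error_functional_def
  using twice_cont_diff_D01(1)[OF \<phi>] twice_cont_diff_continuous_on(1)[OF \<phi>]
  by (simp add: lebesgue_integral_eq_integral continuous_imp_integrable_real)

lemma error_functional_add_scaled:
  assumes \<phi>: "twice_cont_diff \<phi> \<phi>1 \<phi>2" and \<psi>: "twice_cont_diff \<psi> \<psi>1 \<psi>2"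
  shows "error_functional N h C A B (\<lambda>x. \<phi> x + t * \<psi> x)
     = error_functional N h C A B \<phi> + t * error_functional N h C A B \<psi>"
proof -
  have "integral {0..1} (\<lambda>x. \<phi> x + t * \<psi> x) = integral {0..1} \<phi> + t * integral {0..1} \<psi>"
    using twice_cont_diff_continuous_on(1)[OF \<phi>] twice_cont_diff_continuous_on(1)[OF \<psi>]
    by (simp add: integral_add integrable_continuous_real continuous_on_mult_left)
  then show ?thesis
    by (simp add: error_functional_twice_cont_diff[OF twice_cont_diff_add_scaled[OF \<phi> \<psi>]]
      error_functional_twice_cont_diff[OF \<phi>] error_functional_twice_cont_diff[OF \<psi>]
      sum.distrib sum_distrib_left algebra_simps)
qed

lemma twice_cont_diff_scale:
  assumes \<phi>: "twice_cont_diff \<phi> \<phi>1 \<phi>2"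
  shows "norm_L22 (\<lambda>x. c * \<phi> x) = \<bar>c\<bar> * norm_L22 \<phi>"
    and "(\<lambda>x. c * \<phi> x) \<in> L22"
    and "error_functional N h C A B (\<lambda>x. c * \<phi> x) = c * error_functional N h C A B \<phi>"
proof -
  have 0: "twice_cont_diff (\<lambda>x. 0) (\<lambda>x. 0) (\<lambda>x. 0)"
    by (simp add: twice_cont_diff_def)
  have *: "twice_cont_diff (\<lambda>x. c * \<phi> x) (\<lambda>x. c * \<phi>1 x) (\<lambda>x. c * \<phi>2 x)"
    using twice_cont_diff_add_scaled[OF 0 \<phi>, of c] by simp
  show "norm_L22 (\<lambda>x. c * \<phi> x) = \<bar>c\<bar> * norm_L22 \<phi>"
    by (simp add: twice_cont_diff_L22(2)[OF *] twice_cont_diff_L22(2)[OF \<phi>] power_mult_distrib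
        real_sqrt_mult)
  show "(\<lambda>x. c * \<phi> x) \<in> L22" by (rule twice_cont_diff_L22(1)[OF *])
  show "error_functional N h C A B (\<lambda>x. c * \<phi> x) = c * error_functional N h C A B \<phi>"
    using error_functional_add_scaled[OF 0 \<phi>, of N h C A B c]
    by (simp add: error_functional_twice_cont_diff[OF 0])
qed

lemma error_functional_le_error_norm:
  assumes \<phi>: "twice_cont_diff \<phi> \<phi>1 \<phi>2" and pos: "norm_L22 \<phi> > 0"
  shows "ereal (\<bar>error_functional N h C A B \<phi>\<bar> / norm_L22 \<phi>) \<le> error_norm N h C A B"
proof -
  let ?\<psi> = "\<lambda>x. inverse (norm_L22 \<phi>) * \<phi> x"
  have "norm_L22 ?\<psi> = 1" using pos twice_cont_diff_scale(1)[OF \<phi>] by simp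
  then have "ereal \<bar>error_functional N h C A B ?\<psi>\<bar> \<le> error_norm N h C A B"
    unfolding error_norm_def using twice_cont_diff_scale(2)[OF \<phi>] by (intro SUP_upper) blast
  moreover have "\<bar>error_functional N h C A B ?\<psi>\<bar> = \<bar>error_functional N h C A B \<phi>\<bar> / norm_L22 \<phi>"
    using pos unfolding twice_cont_diff_scale(3)[OF \<phi>] by (simp add: abs_mult divide_inverse)
  ultimately show ?thesis by simp
qed

section \<open>Independence of Hermite functionals\<close>

text \<open>
  Let \<open>W\<close> be the product of the \<open>X - x i\<close> over all nodes but \<open>x j\<close>. The polynomial \<open>(X - x j) W\<^sup>2\<close>
  vanishes at all nodes and has nonzero derivative only at \<open>x j\<close>, which isolates \<open>d j\<close>. Once all \<open>d i\<close>
  are known to vanish, \<open>W\<close> itself isolates \<open>w j\<close>.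
\<close>
lemma hermite_functionals_independent:
  fixes x w d :: "'a \<Rightarrow> real"
  assumes "finite I" and inj: "inj_on x I"
    and zero: "\<And>p. (\<Sum>i\<in>I. w i * poly p (x i) + d i * poly (pderiv p) (x i)) = 0"
    and "j \<in> I"
  shows "w j = 0" and "d j = 0"
proof -
  define W where "W j = (\<Prod>i\<in>I - {j}. [:- x i, 1:])" for j
  have W0: "poly (W j) (x i) = 0" if "i \<in> I" "i \<noteq> j" for i j
    using that \<open>finite I\<close> by (auto simp: W_def poly_prod intro!: prod_zero bexI[of _ i])
  have W1: "poly (W j) (x j) \<noteq> 0" if "j \<in> I" for j
    using that \<open>finite I\<close> inj by (auto simp: W_def poly_prod inj_on_def)
  have d0: "d j = 0" if "j \<in> I" for j
  proof -
    define p where "p = [:- x j, 1:] * (W j * W j)"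
    have dp: "pderiv p = [:- x j, 1:] * pderiv (W j * W j) + W j * W j * pderiv [:- x j, 1:]"
      unfolding p_def by (rule pderiv_mult)
    have "poly p (x i) = 0" if "i \<in> I" for i
      using W0[OF that, of j] by (cases "i = j") (auto simp: p_def)
    moreover have "poly (pderiv p) (x i) = (if i = j then (poly (W j) (x j))\<^sup>2 else 0)" if "i \<in> I" for i
      using W0[OF that, of j] by (auto simp: dp pderiv_mult pderiv_pCons power2_eq_square)
    ultimately have "(\<Sum>i\<in>I. w i * poly p (x i) + d i * poly (pderiv p) (x i))
        = (\<Sum>i\<in>I. if i = j then d j * (poly (W j) (x j))\<^sup>2 else 0)"
      by (intro sum.cong) auto
    then show ?thesis using zero[of p] \<open>finite I\<close> that W1[OF that] by (simp add: sum.delta)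
  qed
  have "(\<Sum>i\<in>I. w i * poly (W j) (x i) + d i * poly (pderiv (W j)) (x i))
      = (\<Sum>i\<in>I. if i = j then w j * poly (W j) (x j) else 0)"
    using W0 d0 by (intro sum.cong) auto
  then show "w j = 0" using zero[of "W j"] \<open>finite I\<close> \<open>j \<in> I\<close> W1[OF \<open>j \<in> I\<close>] by (simp add: sum.delta)
  show "d j = 0" using d0 \<open>j \<in> I\<close> .
qed

section \<open>The extremal spline\<close>

text \<open>
  These are \<open>(B\<^sub>4 + 1 / 30) / 24\<close>, \<open>B\<^sub>3 / 6\<close> and \<open>B\<^sub>2 / 2\<close> for the Bernoulli polynomials \<open>B\<^sub>k\<close>, each the
  derivative of the one before. The constant \<open>1 / 30\<close> makes the first one vanish at 0 and 1, to second
  order since \<open>B\<^sub>3\<close> vanishes there as well.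
\<close>
definition bern4 :: "real \<Rightarrow> real" where "bern4 y = y\<^sup>2 * (1 - y)\<^sup>2 / 24"
definition bern3 :: "real \<Rightarrow> real" where "bern3 y = y * (1 - y) * (1 - 2 * y) / 12"
definition bern2 :: "real \<Rightarrow> real" where "bern2 y = y\<^sup>2 / 2 - y / 2 + 1 / 12"

definition spline :: "real \<Rightarrow> real \<Rightarrow> real" where "spline h x = h ^ 4 * bern4 (frac (x / h))"
definition kernel :: "real \<Rightarrow> real \<Rightarrow> real" where "kernel h x = h\<^sup>2 * bern2 (frac (x / h))"

definition trapezoid_weight :: "nat \<Rightarrow> real \<Rightarrow> nat \<Rightarrow> real" where
  "trapezoid_weight N h \<beta> = (if \<beta> = 0 \<or> \<beta> = N then h / 2 else h)"

lemma bern_ends: "bern4 0 = 0" "bern4 1 = 0" "bern3 0 = 0" "bern3 1 = 0" "bern2 0 = bern2 1"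
  by (simp_all add: bern4_def bern3_def bern2_def)

lemma bern_derivatives:
  "(bern4 has_real_derivative bern3 y) (at y)" "(bern3 has_real_derivative bern2 y) (at y)"
  unfolding bern4_def[abs_def] bern3_def[abs_def] bern2_def[abs_def]
  by (auto intro!: derivative_eq_intros simp: field_simps power2_eq_square power3_eq_cube)

lemma continuous_kernel: "continuous_on S (kernel h)"
proof -
  have "continuous_on UNIV bern2" unfolding bern2_def[abs_def] by (intro continuous_intros) auto
  then have "continuous_on UNIV (\<lambda>y. bern2 (frac y))"
    by (rule continuous_periodic) (rule bern_ends)
  then have "continuous_on S (\<lambda>x. bern2 (frac (x / h)))"
    by (rule continuous_on_compose2) (auto intro!: continuous_intros simp: divide_inverse)
  then show ?thesis unfolding kernel_def[abs_def] by (rule continuous_on_mult_left)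
qed

text \<open>
  The periodic extensions of \<open>bern4\<close> and \<open>bern3\<close> are differentiable at the integers because value and
  derivative agree at 0 and 1. The derivative of \<open>bern2\<close> takes the values \<open>-1 / 2\<close> and \<open>1 / 2\<close> there,
  so smoothness ends at this order.
\<close>
lemma twice_cont_diff_spline:
  assumes "h > 0"
  shows "twice_cont_diff (spline h) (\<lambda>x. h ^ 3 * bern3 (frac (x / h))) (kernel h)"
proof -
  have scale: "((\<lambda>x. h ^ Suc k * P (frac (x / h))) has_real_derivative h ^ k * Q (frac (x / h))) (at x)"
    if "\<And>y. (P has_real_derivative Q y) (at y)" "P 0 = P 1" "Q 0 = Q 1" for P Q k x
  proof -
    have "((\<lambda>x. P (frac (x / h))) has_real_derivative Q (frac (x / h)) * (1 / h)) (at x)"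
      by (rule DERIV_chain2[OF has_real_derivative_periodic[OF that]])
        (use assms in \<open>auto intro!: derivative_eq_intros\<close>)
    from DERIV_cmult[OF this, of "h ^ Suc k"] show ?thesis using assms by simp
  qed
  show ?thesis
    unfolding twice_cont_diff_def spline_def[abs_def] kernel_def[abs_def]
    using scale[OF bern_derivatives(1), of 3] scale[OF bern_derivatives(2), of 2]
      continuous_kernel[of UNIV h] bern_ends
    by (simp add: kernel_def[abs_def] eval_nat_numeral)
qed

lemma integral_periodic_unit:
  assumes "\<And>y. (G has_real_derivative g y) (at y)" and "g 0 = g 1" and "N \<ge> 1" and h: "h = 1 / real N"
  shows "integral {0..1} (\<lambda>x. c * g (frac (x / h))) = c * (G 1 - G 0)"
proof -
  have "h > 0" "h * real N = 1" using assms(3) h by auto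
  then have "((\<lambda>x. g (frac (x / h))) has_integral (G 1 - G 0)) {0..1}"
    using has_integral_periodic_cells[OF assms(1,2), of h N]
    by (metis mult.assoc mult.commute mult.left_neutral)
  from has_integral_mult_right[OF this] show ?thesis by (rule integral_unique)
qed

lemma integral_spline:
  assumes "N \<ge> 1" and "h = 1 / real N"
  shows "integral {0..1} (spline h) = h ^ 4 / 720"
proof -
  define G where "G y = (y ^ 3 / 3 - y ^ 4 / 2 + y ^ 5 / 5) / 24" for y :: real
  have "(G has_real_derivative bern4 y) (at y)" for y
    unfolding G_def[abs_def] bern4_def
    by (auto intro!: derivative_eq_intros simp: field_simps eval_nat_numeral)
  from integral_periodic_unit[OF this _ assms, of "h ^ 4"] show ?thesis
    by (simp add: spline_def[abs_def] bern_ends G_def)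
qed

lemma integral_kernel_squared:
  assumes "N \<ge> 1" and "h = 1 / real N"
  shows "integral {0..1} (\<lambda>x. (kernel h x)\<^sup>2) = h ^ 4 / 720"
proof -
  define G where "G y = (y ^ 5 / 5 - y ^ 4 / 2 + 4 / 9 * y ^ 3 - y\<^sup>2 / 6 + y / 36) / 4" for y :: real
  have "(G has_real_derivative (bern2 y)\<^sup>2) (at y)" for y
    unfolding G_def[abs_def] bern2_def
    by (auto intro!: derivative_eq_intros simp: field_simps eval_nat_numeral)
  from integral_periodic_unit[OF this _ assms, of "h ^ 4"] show ?thesis
    by (simp add: kernel_def[abs_def] bern_ends G_def power_mult_distrib flip: power_mult)
qed

text \<open>
  The spline and its derivative vanish at all nodes, so the quadrature sum is zero whatever the
  coefficients are, and only the integral remains.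
\<close>
lemma error_functional_spline:
  assumes "N \<ge> 1" and h: "h = 1 / real N"
  shows "error_functional N h C A B (spline h) = h ^ 4 / 720"
proof -
  have "h > 0" using assms by simp
  have "spline h (h * real \<beta>) = 0" for \<beta>
    using \<open>h > 0\<close> by (simp add: spline_def frac_eq_0_iff[THEN iffD2] bern_ends)
  moreover have "bern3 (frac (1 / h)) = 0"
    using h by (simp add: frac_eq_0_iff[THEN iffD2] bern_ends)
  ultimately show ?thesis
    by (simp add: error_functional_twice_cont_diff[OF twice_cont_diff_spline[OF \<open>h > 0\<close>]]
      integral_spline[OF assms] bern_ends)
qed

lemma norm_spline:
  assumes "N \<ge> 1" and h: "h = 1 / real N"
  shows "norm_L22 (spline h) = sqrt (h ^ 4 / 720)"
  using twice_cont_diff_L22(2)[OF twice_cont_diff_spline[of h]] integral_kernel_squared[OF assms] assms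
  by simp

lemma error_norm_ge:
  assumes "N \<ge> 1" and h: "h = 1 / real N"
  shows "error_norm N h C A B \<ge> ereal (sqrt (h ^ 4 / 720))"
proof -
  have "h > 0" using assms by simp
  have "ereal (\<bar>h ^ 4 / 720\<bar> / sqrt (h ^ 4 / 720)) \<le> error_norm N h C A B"
    using error_functional_le_error_norm[OF twice_cont_diff_spline[OF \<open>h > 0\<close>], of N h C A B]
      norm_spline[OF assms] error_functional_spline[OF assms] \<open>h > 0\<close> by simp
  moreover have "\<bar>h ^ 4 / 720\<bar> / sqrt (h ^ 4 / 720) = sqrt (h ^ 4 / 720)"
    using real_div_sqrt[of "h ^ 4 / 720"] by simp
  ultimately show ?thesis by simp
qed

section \<open>The error norm of the corrected trapezoid rule\<close>

lemma L22_second_derivative: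
  assumes "\<phi> \<in> L22"
  obtains S where "negligible S"
    "\<And>x. x \<in> {0..1} - S \<Longrightarrow> (D01 \<phi> has_vector_derivative D01 (D01 \<phi>) x) (at x within {0..1})"
proof -
  have "AE x in lebesgue_on {0..1}. D01 \<phi> differentiable (at x within {0..1})"
    using assms by (simp add: L22_def)
  then have "AE x in lebesgue. x \<in> {0..1} \<longrightarrow> D01 \<phi> differentiable (at x within {0..1})"
    by (subst (asm) AE_restrict_space_iff) auto
  then obtain S where "S \<in> null_sets lebesgue"
    "{x \<in> space lebesgue. \<not> (x \<in> {0..1} \<longrightarrow> D01 \<phi> differentiable (at x within {0..1}))} \<subseteq> S"
    unfolding eventually_ae_filter by blast
  then have "negligible S" "\<And>x. x \<in> {0..1} - S \<Longrightarrow> D01 \<phi> differentiable (at x within {0..1})"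
    by (auto simp: negligible_iff_null_sets)
  then show ?thesis using that vector_derivative_works unfolding D01_def[of "D01 \<phi>"] by blast
qed

text \<open>
  The sum of the cell identities. The values at interior nodes occur in two cells and get weight \<open>h\<close>,
  while the derivative terms telescope and survive only at 0 and 1.
\<close>
lemma trapezoid_kernel:
  assumes "N \<ge> 1" and h: "h = 1 / real N" and "\<phi> \<in> L22"
  shows "((\<lambda>x. \<phi> x - kernel h x * D01 (D01 \<phi>) x) has_integral
    ((\<Sum>\<beta>=0..N. trapezoid_weight N h \<beta> * \<phi> (h * real \<beta>)) + h\<^sup>2 / 12 * (D01 \<phi> 0 - D01 \<phi> 1))) {0..1}"
proof -
  have "h > 0" and hN: "h * real N = 1" using assms by auto
  obtain S where S: "negligible S"
    "\<And>x. x \<in> {0..1} - S \<Longrightarrow> (D01 \<phi> has_vector_derivative D01 (D01 \<phi>) x) (at x within {0..1})"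
    using L22_second_derivative[OF \<open>\<phi> \<in> L22\<close>] by blast
  have d\<phi>: "(\<phi> has_vector_derivative D01 \<phi> x) (at x within {0..1})" if "x \<in> {0..1}" for x
    using \<open>\<phi> \<in> L22\<close> that vector_derivative_works
    unfolding L22_def D01_def[of \<phi>] differentiable_on_def by blast
  have AC: "absolutely_continuous_fun_on {0..1} (D01 \<phi>)" using \<open>\<phi> \<in> L22\<close> by (simp add: L22_def)
  let ?I = "\<lambda>n. h / 2 * (\<phi> (h * real n) + \<phi> (h * real (Suc n)))
      + h\<^sup>2 / 12 * (D01 \<phi> (h * real n) - D01 \<phi> (h * real (Suc n)))"
  have "((\<lambda>x. \<phi> x - kernel h x * D01 (D01 \<phi>) x) has_integral (\<Sum>n<N. ?I n)) {0..h * real N}"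
  proof (rule has_integral_cells)
    fix n assume "n < N"
    let ?a = "h * real n" and ?b = "h * real (Suc n)"
    have len: "?b - ?a = h" by (simp add: algebra_simps)
    have "?b \<le> h * real N" using \<open>n < N\<close> \<open>h > 0\<close> by (intro mult_left_mono) auto
    then have sub: "{?a..?b} \<subseteq> {0..1}" using \<open>h > 0\<close> hN by auto
    have ker: "kernel h x = (x - ?a)\<^sup>2 / 2 - (?b - ?a) / 2 * (x - ?a) + (?b - ?a)\<^sup>2 / 12"
      if "x \<in> {?a..?b}" for x
    proof -
      have "kernel h x = h\<^sup>2 * bern2 (x / h - real n)"
        unfolding kernel_def by (subst frac_on_cell[OF bern_ends(5) \<open>h > 0\<close> that]) simp
      also have "\<dots> = (x - ?a)\<^sup>2 / 2 - h / 2 * (x - ?a) + h\<^sup>2 / 12"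
        using \<open>h > 0\<close> by (simp add: bern2_def field_simps power2_eq_square)
      finally show ?thesis by (simp only: len)
    qed
    have "((\<lambda>x. \<phi> x - ((x - ?a)\<^sup>2 / 2 - (?b - ?a) / 2 * (x - ?a) + (?b - ?a)\<^sup>2 / 12) * D01 (D01 \<phi>) x)
      has_integral ((?b - ?a) / 2 * (\<phi> ?a + \<phi> ?b) + (?b - ?a)\<^sup>2 / 12 * (D01 \<phi> ?a - D01 \<phi> ?b))) {?a..?b}"
    proof (rule trapezoid_cell[OF _ _ _ S(1)])
      show "?a \<le> ?b" using \<open>h > 0\<close> by simp
      show "(\<phi> has_vector_derivative D01 \<phi> x) (at x within {?a..?b})" if "x \<in> {?a..?b}" for x
        using d\<phi>[of x] that sub by (meson has_vector_derivative_within_subset subsetD)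
      show "absolutely_continuous_fun_on {?a..?b} (D01 \<phi>)"
        by (rule absolutely_continuous_fun_on_subset[OF AC sub])
      show "(D01 \<phi> has_vector_derivative D01 (D01 \<phi>) x) (at x within {?a..?b})"
        if "x \<in> {?a..?b} - S" for x
        using S(2)[of x] that sub by (meson DiffD1 DiffD2 DiffI has_vector_derivative_within_subset subsetD)
    qed
    then show "((\<lambda>x. \<phi> x - kernel h x * D01 (D01 \<phi>) x) has_integral ?I n) {?a..?b}"
      unfolding len by (rule has_integral_eq[rotated]) (use ker len in simp)
  qed (use \<open>h > 0\<close> in simp)
  moreover have "(\<Sum>n<N. ?I n) = (\<Sum>\<beta>=0..N. trapezoid_weight N h \<beta> * \<phi> (h * real \<beta>))
      + h\<^sup>2 / 12 * (D01 \<phi> 0 - D01 \<phi> 1)"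
  proof -
    \<comment> \<open>Generalised from \<open>N\<close> for the induction; \<open>h\<close> stays fixed while the number of cells grows.\<close>
    have trap: "(\<Sum>n<m. h / 2 * (f n + f (Suc n))) = (\<Sum>\<beta>=0..m. trapezoid_weight m h \<beta> * f \<beta>)"
      if "m \<ge> 1" for f m
      using that
    proof (induction m rule: dec_induct)
      case base
      then show ?case by (simp add: trapezoid_weight_def algebra_simps)
    next
      case (step m)
      have "(\<Sum>\<beta>=0..<m. trapezoid_weight (Suc m) h \<beta> * f \<beta>) = (\<Sum>\<beta>=0..<m. trapezoid_weight m h \<beta> * f \<beta>)"
        by (rule sum.cong) (auto simp: trapezoid_weight_def)
      then show ?case using step
        by (simp add: trapezoid_weight_def atLeastLessThanSuc_atLeastAtMost[symmetric] algebra_simps)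
    qed
    have "(\<Sum>n<N. h\<^sup>2 / 12 * (D01 \<phi> (h * real n) - D01 \<phi> (h * real (Suc n))))
        = h\<^sup>2 / 12 * (D01 \<phi> (h * real 0) - D01 \<phi> (h * real N))"
      unfolding sum_distrib_left[symmetric]
      by (subst sum_lessThan_telescope'[of "\<lambda>n. D01 \<phi> (h * real n)"]) simp
    then show ?thesis
      using trap[OF \<open>N \<ge> 1\<close>, of "\<lambda>n. \<phi> (h * real n)"] hN by (simp only: sum.distrib) simp
  qed
  ultimately show ?thesis using hN by simp
qed

text \<open>
  The inequality of Cauchy and Schwarz for \<open>\<integral>K \<phi>''\<close>, where \<open>\<parallel>K\<parallel> = E\<close> and \<open>\<parallel>\<phi>''\<parallel> = 1\<close> are known. It is obtained
  by integrating the pointwise bound \<open>\<bar>K \<phi>''\<bar> \<le> (K\<^sup>2 / E + E \<phi>''\<^sup>2) / 2\<close>, which also shows that the product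
  is integrable.
\<close>
lemma error_norm_trapezoid_le:
  assumes "N \<ge> 1" and h: "h = 1 / real N"
  shows "error_norm N h (trapezoid_weight N h) (h\<^sup>2 / 12) (- (h\<^sup>2 / 12)) \<le> ereal (sqrt (h ^ 4 / 720))"
  unfolding error_norm_def
proof (rule SUP_least)
  fix \<phi> assume "\<phi> \<in> {\<phi> \<in> L22. norm_L22 \<phi> = 1}"
  then have \<phi>: "\<phi> \<in> L22" and "norm_L22 \<phi> = 1" by auto
  define E where "E = sqrt (h ^ 4 / 720)"
  have E: "E > 0" "E\<^sup>2 = h ^ 4 / 720" using assms by (auto simp: E_def)
  let ?L = "lebesgue_on {0..1::real}" and ?K = "kernel h" and ?f = "D01 (D01 \<phi>)"
  have f2: "?f \<in> borel_measurable ?L" "integrable ?L (\<lambda>x. (?f x)\<^sup>2)" "(\<integral>x. (?f x)\<^sup>2 \<partial>?L) = 1"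
    using \<phi> \<open>norm_L22 \<phi> = 1\<close> by (auto simp: L22_def norm_L22_def)
  have K2: "integrable ?L (\<lambda>x. (?K x)\<^sup>2)"
    by (intro continuous_imp_integrable_real continuous_intros continuous_kernel)
  then have K2E: "(\<integral>x. (?K x)\<^sup>2 \<partial>?L) = E\<^sup>2"
    by (simp add: lebesgue_integral_eq_integral integral_kernel_squared[OF assms] E(2))
  define g where "g x = ((?K x)\<^sup>2 / E + E * (?f x)\<^sup>2) / 2" for x
  have le: "\<bar>?K x * ?f x\<bar> \<le> g x" for x
  proof -
    have "0 \<le> (\<bar>?K x\<bar> - E * \<bar>?f x\<bar>)\<^sup>2 / E" using E by simp
    also have "\<dots> = 2 * (g x - \<bar>?K x * ?f x\<bar>)"
      using E by (simp add: g_def field_simps power2_eq_square abs_mult)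
    finally show ?thesis by simp
  qed
  have g: "integrable ?L g" unfolding g_def using K2 f2 by auto
  have Kf: "integrable ?L (\<lambda>x. ?K x * ?f x)"
  proof (rule Bochner_Integration.integrable_bound[OF g])
    show "(\<lambda>x. ?K x * ?f x) \<in> borel_measurable ?L"
      using f2(1) continuous_imp_measurable_on_sets_lebesgue[OF continuous_kernel, of "{0..1}" h]
      by (intro borel_measurable_times) auto
    show "AE x in ?L. norm (?K x * ?f x) \<le> norm (g x)"
      using le by (intro AE_I2) (metis abs_ge_self order_trans real_norm_def)
  qed
  have "continuous_on {0..1} \<phi>"
    using \<phi> by (simp add: L22_def differentiable_imp_continuous_on)
  then have int\<phi>: "integrable ?L \<phi>" by (rule continuous_imp_integrable_real)
  have "((\<lambda>x. \<phi> x - ?K x * ?f x) has_integral ((\<integral>x. \<phi> x \<partial>?L) - (\<integral>x. ?K x * ?f x \<partial>?L))) {0..1}"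
    by (intro has_integral_diff has_integral_integral_lebesgue_on int\<phi> Kf) auto
  from has_integral_unique[OF this trapezoid_kernel[OF assms \<phi>]]
  have "error_functional N h (trapezoid_weight N h) (h\<^sup>2 / 12) (- (h\<^sup>2 / 12)) \<phi> = (\<integral>x. ?K x * ?f x \<partial>?L)"
    by (simp add: error_functional_def field_simps)
  also have "\<bar>\<dots>\<bar> \<le> (\<integral>x. \<bar>?K x * ?f x\<bar> \<partial>?L)" by (rule integral_abs_bound)
  also have "\<dots> \<le> (\<integral>x. g x \<partial>?L)"
    using Kf g le by (intro integral_mono) auto
  also have "\<dots> = (E\<^sup>2 / E + E * 1) / 2"
    unfolding g_def using K2 f2 K2E by simp
  also have "\<dots> = E" using E by (simp add: power2_eq_square)
  finally show "ereal \<bar>error_functional N h (trapezoid_weight N h) (h\<^sup>2 / 12) (- (h\<^sup>2 / 12)) \<phi>\<bar>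
      \<le> ereal (sqrt (h ^ 4 / 720))" by (simp add: E_def)
qed

section \<open>Optimality and uniqueness\<close>

text \<open>
  With \<open>\<ell>\<close> the error functional, the function \<open>E\<^sup>2 \<parallel>\<phi> + t \<psi>\<parallel>\<^sup>2 - \<ell>(\<phi> + t \<psi>)\<^sup>2\<close> of \<open>t\<close> is nonnegative
  near 0 and vanishes at 0, so its derivative there is zero. An extremal function thus determines the
  functional on smooth functions: up to a factor, \<open>\<ell>\<close> is the inner product with \<open>\<phi>''\<close>.
\<close>
lemma extremal_first_variation:
  assumes \<phi>: "twice_cont_diff \<phi> \<phi>1 \<phi>2" and \<psi>: "twice_cont_diff \<psi> \<psi>1 \<psi>2"
    and "norm_L22 \<phi> > 0" and "E > 0" and bound: "error_norm N h C A B \<le> ereal E"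
    and extremal: "error_functional N h C A B \<phi> = E * norm_L22 \<phi>"
  shows "norm_L22 \<phi> * error_functional N h C A B \<psi> = E * integral {0..1} (\<lambda>x. \<phi>2 x * \<psi>2 x)"
proof -
  define c where "c = integral {0..1} (\<lambda>x. \<phi>2 x * \<psi>2 x)"
  define M where "M = integral {0..1} (\<lambda>x. (\<psi>2 x)\<^sup>2)"
  define r where "r = norm_L22 \<phi>"
  define l where "l = error_functional N h C A B \<psi>"
  define J where "J t = r\<^sup>2 + 2 * t * c + t\<^sup>2 * M" for t
  note cont = twice_cont_diff_continuous_on(2)[OF \<phi>] twice_cont_diff_continuous_on(2)[OF \<psi>]
  have "r > 0" using assms(3) by (simp add: r_def)
  have nonneg: "integral {0..1} (\<lambda>x. (u x)\<^sup>2) \<ge> 0" for u :: "real \<Rightarrow> real"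
    by (cases "(\<lambda>x. (u x)\<^sup>2) integrable_on {0..1}") (auto intro: integral_nonneg simp: not_integrable_integral)
  have r2: "r\<^sup>2 = integral {0..1} (\<lambda>x. (\<phi>2 x)\<^sup>2)"
    unfolding r_def twice_cont_diff_L22(2)[OF \<phi>] using nonneg by simp
  have norm: "norm_L22 (\<lambda>x. \<phi> x + t * \<psi> x) = sqrt (J t)" for t
  proof -
    have "integral {0..1} (\<lambda>x. (\<phi>2 x + t * \<psi>2 x)\<^sup>2)
        = integral {0..1} (\<lambda>x. (\<phi>2 x)\<^sup>2 + (2 * t * (\<phi>2 x * \<psi>2 x) + t\<^sup>2 * (\<psi>2 x)\<^sup>2))"
      by (simp add: power2_eq_square algebra_simps)
    also have "\<dots> = J t"
      unfolding J_def r2 c_def M_def using cont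
      by (subst integral_add, (intro integrable_continuous_real continuous_intros; simp)+)
        (subst integral_add, (intro integrable_continuous_real continuous_intros; simp)+, simp)
    finally show ?thesis
      unfolding twice_cont_diff_L22(2)[OF twice_cont_diff_add_scaled[OF \<phi> \<psi>]] by simp
  qed
  have le: "(E * r + t * l)\<^sup>2 \<le> E\<^sup>2 * J t" if "J t > 0" for t
  proof -
    let ?v = "\<lambda>x. \<phi> x + t * \<psi> x"
    have "ereal (\<bar>error_functional N h C A B ?v\<bar> / norm_L22 ?v) \<le> error_norm N h C A B"
      using that norm[of t]
      by (intro error_functional_le_error_norm[OF twice_cont_diff_add_scaled[OF \<phi> \<psi>]]) simp
    moreover have "error_functional N h C A B ?v = E * r + t * l"
      using extremal error_functional_add_scaled[OF \<phi> \<psi>] by (simp add: l_def r_def)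
    ultimately have "ereal (\<bar>E * r + t * l\<bar> / sqrt (J t)) \<le> ereal E"
      using bound norm[of t] by (auto simp del: ereal_less_eq intro: order_trans)
    then have "\<bar>E * r + t * l\<bar> / sqrt (J t) \<le> E" by simp
    then have "\<bar>E * r + t * l\<bar> \<le> E * sqrt (J t)" using that by (simp add: field_simps)
    then have "\<bar>E * r + t * l\<bar>\<^sup>2 \<le> (E * sqrt (J t))\<^sup>2" by (intro power_mono) auto
    then show ?thesis using that by (simp add: power_mult_distrib)
  qed
  \<comment> \<open>Division by the norm needs \<open>J t > 0\<close>, which is only guaranteed near \<open>t = 0\<close>.\<close>
  have "isCont J 0" unfolding J_def[abs_def] by (intro continuous_intros)
  moreover have "J 0 > 0" using \<open>r > 0\<close> by (simp add: J_def)
  ultimately have "\<forall>\<^sub>F t in at 0. J t > 0" by (auto simp: isCont_def intro: order_tendstoD)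
  then obtain d where "d > 0" and d: "\<And>t. t \<noteq> 0 \<Longrightarrow> \<bar>t\<bar> < d \<Longrightarrow> J t > 0"
    by (auto simp: eventually_at dist_real_def)
  have "2 * E\<^sup>2 * c - 2 * E * r * l = 0"
  proof (rule DERIV_local_min[OF _ \<open>d > 0\<close>])
    show "((\<lambda>t. E\<^sup>2 * J t - (E * r + t * l)\<^sup>2) has_real_derivative 2 * E\<^sup>2 * c - 2 * E * r * l) (at 0)"
      unfolding J_def by (auto intro!: derivative_eq_intros)
    show "\<forall>t. \<bar>0 - t\<bar> < d \<longrightarrow> E\<^sup>2 * J 0 - (E * r + 0 * l)\<^sup>2 \<le> E\<^sup>2 * J t - (E * r + t * l)\<^sup>2"
    proof (intro allI impI)
      fix t assume "\<bar>0 - t\<bar> < d"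
      then have "J t > 0" using d[of t] \<open>J 0 > 0\<close> by (cases "t = 0") auto
      from le[OF this] show "E\<^sup>2 * J 0 - (E * r + 0 * l)\<^sup>2 \<le> E\<^sup>2 * J t - (E * r + t * l)\<^sup>2"
        by (simp add: J_def power_mult_distrib)
    qed
  qed
  then have "E * (E * c - r * l) = 0" by (simp add: power2_eq_square algebra_simps)
  then show ?thesis using \<open>E > 0\<close> by (simp add: c_def r_def l_def)
qed

text \<open>
  The spline is extremal for both formulas, so they agree on all polynomials. Their difference is a
  vanishing combination of values at the nodes and derivatives at the two end nodes, and
  independence of Hermite functionals makes all its coefficients zero.
\<close>
lemma error_norm_minimal_unique:
  assumes "N \<ge> 1" and h: "h = 1 / real N"
    and "error_norm N h C A B \<le> ereal (sqrt (h ^ 4 / 720))"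
    and "error_norm N h C' A' B' \<le> ereal (sqrt (h ^ 4 / 720))"
  shows "\<forall>\<beta>\<in>{0..N}. C \<beta> = C' \<beta>" and "A = A'" and "B = B'"
proof -
  define E where "E = sqrt (h ^ 4 / 720)"
  have "h > 0" using assms by simp
  then have "E > 0" "E * E = h ^ 4 / 720" by (auto simp: E_def)
  note tcd = twice_cont_diff_spline[OF \<open>h > 0\<close>]
  have *: "error_functional N h C A B (poly p)
      = integral {0..1} (\<lambda>x. kernel h x * poly (pderiv (pderiv p)) x)"
    if "error_norm N h C A B \<le> ereal E" for C A B p
    using extremal_first_variation[OF tcd twice_cont_diff_poly[of p] _ \<open>E > 0\<close> that]
      error_functional_spline[OF assms(1,2)] norm_spline[OF assms(1,2)] \<open>E > 0\<close> \<open>E * E = h ^ 4 / 720\<close>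
    by (simp add: E_def)
  \<comment> \<open>The two coefficients sit at different indices because \<open>N \<ge> 1\<close>.\<close>
  define d where "d i = (if i = 0 then A - A' else 0) + (if i = N then B - B' else 0)" for i
  have zero: "(\<Sum>i\<in>{0..N}. (C i - C' i) * poly p (h * real i) + d i * poly (pderiv p) (h * real i)) = 0" for p
  proof -
    have "(\<Sum>i\<in>{0..N}. d i * poly (pderiv p) (h * real i))
        = (A - A') * poly (pderiv p) 0 + (B - B') * poly (pderiv p) 1"
    proof -
      have "(\<Sum>i\<in>{0..N}. d i * poly (pderiv p) (h * real i))
          = (\<Sum>i\<in>{0..N}. (if i = 0 then (A - A') * poly (pderiv p) 0 else 0)
              + (if i = N then (B - B') * poly (pderiv p) 1 else 0))"
        using assms(1,2) by (intro sum.cong) (auto simp: d_def algebra_simps)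
      then show ?thesis by (simp add: sum.distrib sum.delta)
    qed
    moreover have "error_functional N h C A B (poly p) = error_functional N h C' A' B' (poly p)"
      using *[of C A B p] *[of C' A' B' p] assms(3,4) by (simp add: E_def)
    ultimately show ?thesis
      by (simp add: error_functional_twice_cont_diff[OF twice_cont_diff_poly] sum.distrib
          left_diff_distrib sum_subtractf)
  qed
  have inj: "inj_on (\<lambda>i. h * real i) {0..N}" using \<open>h > 0\<close> by (auto simp: inj_on_def)
  note H = hermite_functionals_independent[OF _ inj zero]
  show "\<forall>\<beta>\<in>{0..N}. C \<beta> = C' \<beta>" using H(1) by fastforce
  show "A = A'" using H(2)[of 0] assms(1) by (simp add: d_def)
  show "B = B'" using H(2)[of N] assms(1) by (simp add: d_def)
qed

theorem corollary5p1:
  fixes N :: nat and h :: real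
  assumes "N \<ge> 1" and "h = 1 / real N"
  shows "(\<exists>!(C, A, B). C \<in> extensional {0..N} \<and> optimal_formula N h C A B) \<and>
    (\<forall>C A B. optimal_formula N h C A B \<longrightarrow>
       (\<forall>\<beta>\<in>{0..N}. C \<beta> = (if \<beta> = 0 \<or> \<beta> = N then h / 2 else h)) \<and>
       A = h\<^sup>2 / 12 \<and> B = - (h\<^sup>2 / 12) \<and>
       (error_norm N h C A B)\<^sup>2 = ereal (h ^ 4 / 720))"
proof -
  define E where "E = sqrt (h ^ 4 / 720)"
  let ?T = "trapezoid_weight N h" and ?A = "h\<^sup>2 / 12"
  have ge: "ereal E \<le> error_norm N h C A B" for C A B
    using error_norm_ge[OF assms] by (simp add: E_def)
  have le: "error_norm N h ?T ?A (- ?A) \<le> ereal E"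
    using error_norm_trapezoid_le[OF assms] by (simp add: E_def)
  have "(INF (C', A', B')\<in>UNIV. error_norm N h C' A' B') = ereal E"
  proof (rule antisym)
    show "(INF (C', A', B')\<in>UNIV. error_norm N h C' A' B') \<le> ereal E"
      using le by (intro INF_lower2[of "(?T, ?A, - ?A)"]) auto
    show "ereal E \<le> (INF (C', A', B')\<in>UNIV. error_norm N h C' A' B')"
      using ge by (intro INF_greatest) auto
  qed
  then have opt: "optimal_formula N h C A B \<longleftrightarrow> error_norm N h C A B = ereal E" for C A B
    by (simp add: optimal_formula_def)
  have coeffs: "(\<forall>\<beta>\<in>{0..N}. C \<beta> = ?T \<beta>) \<and> A = ?A \<and> B = - ?A" if "optimal_formula N h C A B" for C A B
    using error_norm_minimal_unique[OF assms, of C A B ?T ?A "- ?A"] that le by (simp add: opt E_def)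
  have cong: "error_norm N h (restrict ?T {0..N}) ?A (- ?A) = error_norm N h ?T ?A (- ?A)"
    unfolding error_norm_def error_functional_def by simp
  have "\<exists>!(C, A, B). C \<in> extensional {0..N} \<and> optimal_formula N h C A B"
  proof (rule ex1I[of _ "(restrict ?T {0..N}, ?A, - ?A)"])
    show "case (restrict ?T {0..N}, ?A, - ?A) of (C, A, B) \<Rightarrow> C \<in> extensional {0..N} \<and> optimal_formula N h C A B"
      using antisym[OF le ge] by (simp add: opt cong)
    fix y :: "(nat \<Rightarrow> real) \<times> real \<times> real"
    assume "case y of (C, A, B) \<Rightarrow> C \<in> extensional {0..N} \<and> optimal_formula N h C A B"
    then obtain C A B where y: "y = (C, A, B)" and C: "C \<in> extensional {0..N}" "optimal_formula N h C A B"
      by (cases y) auto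
    then have "C = restrict ?T {0..N}"
      using coeffs[OF C(2)] by (intro extensionalityI[OF C(1) restrict_extensional]) auto
    then show "y = (restrict ?T {0..N}, ?A, - ?A)" using y coeffs[OF C(2)] by simp
  qed
  moreover have "E\<^sup>2 = h ^ 4 / 720" by (simp add: E_def)
  ultimately show ?thesis using coeffs by (simp add: opt trapezoid_weight_def)
qed

end
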